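(* Let $L$ be a decomposable lattice and let $P$ be a prime ideal of $L$. The following conditions are equivalent: (1) $P$ is a minimal prime ideal of $L$. (2) $P=\bigcup\{a^{\perp} \mid a\in L,\ a\notin P\}$. (3) For every $x\in P$, $x^{\perp}\not\subseteq P$.
   Context: A decomposable lattice is a distributive lattice $L$ with minimum element $0$ such that for any $a,b\in L$ that are not comparable there exist $\overline{a},\overline{b}\in L$ with $a=\overline{a}\vee(a\wedge b)$, $b=\overline{b}\vee(a\wedge b)$ and $\overline{a}\wedge\overline{b}=0$. An ideal of $L$ is a nonempty subset closed under $\vee$ and downward closed. An ideal $P$ is prime if $P\neq L$ and $a\wedge b\in P$ implies $a\in P$ or $b\in P$; a minimal prime ideal is a prime ideal minimal under inclusion among prime ideals. For $a\in L$, $a^{\perp}=\{x\in L\mid x\wedge a=0\}$. *)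

theory Defs
  imports Main
begin

text \<open>The lattice \<open>L\<close> is the whole carrier type; its minimum \<open>0\<close> is \<^term>\<open>bot\<close>.\<close>

class decomposable_lattice = distrib_lattice + bounded_lattice_bot +
  assumes decomposable:
    "\<not> a \<le> b \<Longrightarrow> \<not> b \<le> a \<Longrightarrow>
      \<exists>a' b'. a = sup a' (inf a b) \<and> b = sup b' (inf a b) \<and> inf a' b' = bot"

definition lattice_ideal :: "'a::lattice set \<Rightarrow> bool" where
  "lattice_ideal I \<longleftrightarrow>
     I \<noteq> {} \<and> (\<forall>x\<in>I. \<forall>y\<in>I. sup x y \<in> I) \<and> (\<forall>x\<in>I. \<forall>y. y \<le> x \<longrightarrow> y \<in> I)"

definition prime_lattice_ideal :: "'a::lattice set \<Rightarrow> bool" where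
  "prime_lattice_ideal P \<longleftrightarrow>
     lattice_ideal P \<and> P \<noteq> UNIV \<and> (\<forall>a b. inf a b \<in> P \<longrightarrow> a \<in> P \<or> b \<in> P)"

definition minimal_prime_lattice_ideal :: "'a::lattice set \<Rightarrow> bool" where
  "minimal_prime_lattice_ideal P \<longleftrightarrow>
     prime_lattice_ideal P \<and> (\<forall>Q. prime_lattice_ideal Q \<and> Q \<subseteq> P \<longrightarrow> Q = P)"

definition perp :: "'a::bounded_lattice_bot \<Rightarrow> 'a set" where
  "perp a = {x. inf x a = bot}"

end

theory Submission imports Defs begin

text \<open>
  Primeness of \<open>P\<close> gives \<open>\<Union> {perp a | a. a \<notin> P} \<subseteq> P\<close>: if \<open>inf x a = bot\<close> with
  \<open>a \<notin> P\<close>, then \<open>x \<in> P\<close>. So the second and the third condition both say that every \<open>x \<in> P\<close>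
  is disjoint from some \<open>a \<notin> P\<close>.

  This condition forces minimality, because a prime ideal \<open>Q \<subseteq> P\<close> contains \<open>inf x a = bot\<close> but
  not \<open>a\<close>, and hence contains \<open>x\<close>. Conversely, suppose that \<open>x \<in> P\<close> is disjoint from no element
  outside \<open>P\<close>. Then the set of all \<open>inf x a\<close> with \<open>a \<notin> P\<close> is closed under meets and avoids
  \<open>bot\<close>, so by the prime ideal theorem for distributive lattices (\<open>prime_ideal_separation\<close>, the
  only use of Zorn's lemma) some prime ideal \<open>Q\<close> avoids that set. Such a \<open>Q\<close> lies inside \<open>P\<close>
  and misses \<open>x\<close>, so \<open>P\<close> is not minimal.
\<close>

lemma lattice_ideal_Union_chain:
  fixes C :: "'a::lattice set set"
  assumes nonempty: "C \<noteq> {}"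
    and ideals: "\<And>I. I \<in> C \<Longrightarrow> lattice_ideal I"
    and chain: "\<And>I J. I \<in> C \<Longrightarrow> J \<in> C \<Longrightarrow> I \<subseteq> J \<or> J \<subseteq> I"
  shows "lattice_ideal (\<Union>C)"
  unfolding lattice_ideal_def
proof (intro conjI ballI allI impI)
  obtain I where "I \<in> C" using nonempty by blast
  moreover from this have "I \<noteq> {}" using ideals unfolding lattice_ideal_def by simp
  ultimately show "\<Union>C \<noteq> {}" by blast
next
  fix x y assume "x \<in> \<Union>C" "y \<in> \<Union>C"
  then obtain I J where "I \<in> C" "x \<in> I" "J \<in> C" "y \<in> J" by blast
  then obtain K where "K \<in> C" "x \<in> K" "y \<in> K"
    using chain by blast
  then show "sup x y \<in> \<Union>C"
    using ideals unfolding lattice_ideal_def by blast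
next
  fix x y assume "x \<in> \<Union>C" "y \<le> x"
  then show "y \<in> \<Union>C"
    using ideals unfolding lattice_ideal_def by blast
qed

text \<open>The set below is the ideal generated by \<open>I\<close> and \<open>a\<close>.\<close>

lemma lattice_ideal_adjoin:
  fixes I :: "'a::lattice set"
  assumes "lattice_ideal I"
  shows "lattice_ideal {y. \<exists>q\<in>I. y \<le> sup q a}"
  unfolding lattice_ideal_def
proof (intro conjI ballI allI impI)
  have "I \<noteq> {}" using assms unfolding lattice_ideal_def by simp
  then obtain q where "q \<in> I" by blast
  then have "q \<in> {y. \<exists>q\<in>I. y \<le> sup q a}" using sup.cobounded1 by blast
  then show "{y. \<exists>q\<in>I. y \<le> sup q a} \<noteq> {}" by blast
next
  fix x y assume "x \<in> {y. \<exists>q\<in>I. y \<le> sup q a}" "y \<in> {y. \<exists>q\<in>I. y \<le> sup q a}"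
  then obtain q r where "q \<in> I" "x \<le> sup q a" and "r \<in> I" "y \<le> sup r a" by blast
  have "sup q a \<le> sup (sup q r) a" "sup r a \<le> sup (sup q r) a"
    by (intro sup_mono sup.cobounded1 sup.cobounded2 order_refl)+
  with \<open>x \<le> sup q a\<close> \<open>y \<le> sup r a\<close> have "sup x y \<le> sup (sup q r) a"
    by (meson le_supI order_trans)
  moreover have "sup q r \<in> I"
    using assms \<open>q \<in> I\<close> \<open>r \<in> I\<close> unfolding lattice_ideal_def by blast
  ultimately show "sup x y \<in> {y. \<exists>q\<in>I. y \<le> sup q a}" by blast
next
  fix x y assume "x \<in> {y. \<exists>q\<in>I. y \<le> sup q a}" "y \<le> x"
  then show "y \<in> {y. \<exists>q\<in>I. y \<le> sup q a}" using order_trans by blast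
qed

text \<open>
  If neither \<open>a\<close> nor \<open>b\<close> lies in \<open>M\<close>, the ideals generated by \<open>M\<close> together with \<open>a\<close>, and by \<open>M\<close>
  together with \<open>b\<close>, both meet \<open>F\<close>. So \<open>F\<close> has elements below \<open>sup q a\<close> and below \<open>sup q b\<close> for a
  common \<open>q \<in> M\<close>, and their meet is below \<open>sup q (inf a b)\<close> by distributivity. Were \<open>inf a b\<close>
  in \<open>M\<close>, this meet would lie in both \<open>M\<close> and \<open>F\<close>.
\<close>

lemma maximal_disjoint_ideal_prime:
  fixes M F :: "'a::distrib_lattice set"
  assumes ideal: "lattice_ideal M"
    and disjoint: "M \<inter> F = {}"
    and maximal: "\<And>J. lattice_ideal J \<Longrightarrow> J \<inter> F = {} \<Longrightarrow> M \<subseteq> J \<Longrightarrow> J = M"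
    and F_nonempty: "F \<noteq> {}"
    and F_inf: "\<And>f g. f \<in> F \<Longrightarrow> g \<in> F \<Longrightarrow> inf f g \<in> F"
  shows "prime_lattice_ideal M"
  unfolding prime_lattice_ideal_def
proof (intro conjI allI impI)
  show "lattice_ideal M" by (fact ideal)
  show "M \<noteq> UNIV" using disjoint F_nonempty by blast
  have sup_M: "sup x y \<in> M" if "x \<in> M" "y \<in> M" for x y
    using ideal that unfolding lattice_ideal_def by blast
  have down_M: "y \<in> M" if "x \<in> M" "y \<le> x" for x y
    using ideal that unfolding lattice_ideal_def by blast
  have meets_F: "\<exists>f\<in>F. \<exists>q\<in>M. f \<le> sup q c" if "c \<notin> M" for c
  proof (rule ccontr)
    let ?J = "{y. \<exists>q\<in>M. y \<le> sup q c}"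
    assume "\<not> (\<exists>f\<in>F. \<exists>q\<in>M. f \<le> sup q c)"
    then have "?J \<inter> F = {}" by blast
    moreover have "M \<subseteq> ?J" using sup.cobounded1 by blast
    ultimately have "?J = M"
      using maximal lattice_ideal_adjoin[OF ideal] by blast
    moreover have "c \<in> ?J"
      using ideal sup.cobounded2 unfolding lattice_ideal_def by blast
    ultimately show False using that by blast
  qed
  fix a b assume ab: "inf a b \<in> M"
  show "a \<in> M \<or> b \<in> M"
  proof (rule ccontr)
    assume "\<not> (a \<in> M \<or> b \<in> M)"
    then obtain f q g r where f: "f \<in> F" "q \<in> M" "f \<le> sup q a"
      and g: "g \<in> F" "r \<in> M" "g \<le> sup r b"
      using meets_F by meson
    let ?s = "sup q r"
    have "sup q a \<le> sup ?s a" "sup r b \<le> sup ?s b"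
      by (intro sup_mono sup.cobounded1 sup.cobounded2 order_refl)+
    then have "f \<le> sup ?s a" "g \<le> sup ?s b"
      using f(3) g(3) order_trans by blast+
    then have "inf f g \<le> sup ?s (inf a b)"
      unfolding sup_inf_distrib1 by (rule inf_mono)
    then have "inf f g \<in> M"
      using down_M sup_M f(2) g(2) ab by blast
    then show False
      using F_inf f(1) g(1) disjoint by blast
  qed
qed

text \<open>
  The prime ideal theorem: unions of chains preserve both being an ideal and avoiding \<open>F\<close>, so
  there is an ideal maximal among those above \<open>I\<close> that avoid \<open>F\<close>. It is prime by
  \<open>maximal_disjoint_ideal_prime\<close>.
\<close>

lemma prime_ideal_separation:
  fixes I F :: "'a::distrib_lattice set"
  assumes ideal: "lattice_ideal I"
    and disjoint: "I \<inter> F = {}"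
    and F_nonempty: "F \<noteq> {}"
    and F_inf: "\<And>f g. f \<in> F \<Longrightarrow> g \<in> F \<Longrightarrow> inf f g \<in> F"
  obtains Q where "prime_lattice_ideal Q" "I \<subseteq> Q" "Q \<inter> F = {}"
proof -
  let ?A = "{J. lattice_ideal J \<and> I \<subseteq> J \<and> J \<inter> F = {}}"
  have "\<exists>M\<in>?A. \<forall>J\<in>?A. M \<subseteq> J \<longrightarrow> J = M"
  proof (rule subset_Zorn_nonempty)
    show "?A \<noteq> {}" using ideal disjoint by blast
  next
    fix C assume "C \<noteq> {}" and C: "subset.chain ?A C"
    have sub: "C \<subseteq> ?A" using C unfolding subset.chain_def by blast
    have "lattice_ideal (\<Union>C)"
    proof (rule lattice_ideal_Union_chain)
      show "C \<noteq> {}" by fact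
      show "\<And>J. J \<in> C \<Longrightarrow> lattice_ideal J" using sub by blast
      show "\<And>J K. J \<in> C \<Longrightarrow> K \<in> C \<Longrightarrow> J \<subseteq> K \<or> K \<subseteq> J"
        using C unfolding subset_chain_def by blast
    qed
    moreover have "I \<subseteq> \<Union>C" "\<Union>C \<inter> F = {}" using \<open>C \<noteq> {}\<close> sub by blast+
    ultimately show "\<Union>C \<in> ?A" by blast
  qed
  then obtain M where M: "lattice_ideal M" "I \<subseteq> M" "M \<inter> F = {}"
    and max: "\<And>J. J \<in> ?A \<Longrightarrow> M \<subseteq> J \<Longrightarrow> J = M" by auto
  have "prime_lattice_ideal M"
  proof (rule maximal_disjoint_ideal_prime[OF M(1,3) _ F_nonempty F_inf])
    show "\<And>J. lattice_ideal J \<Longrightarrow> J \<inter> F = {} \<Longrightarrow> M \<subseteq> J \<Longrightarrow> J = M"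
      using max M(2) by blast
  qed
  then show thesis using that M by blast
qed

lemma bot_mem_lattice_ideal:
  fixes I :: "'a::{lattice, bounded_lattice_bot} set"
  assumes "lattice_ideal I"
  shows "bot \<in> I"
  using assms bot_least unfolding lattice_ideal_def by blast

text \<open>
  For the direct implication, a failure at \<open>x\<close> yields, by separation, a prime ideal inside \<open>P\<close>
  without \<open>x\<close>. For the converse, \<open>inf x a = bot\<close> lies in every prime ideal below \<open>P\<close>, and
  \<open>a \<notin> P\<close> leaves \<open>x\<close> as the factor that belongs to it.
\<close>

lemma minimal_prime_ideal_iff_disjoint:
  fixes P :: "'a::{distrib_lattice, bounded_lattice_bot} set"
  assumes prime: "prime_lattice_ideal P"
  shows "minimal_prime_lattice_ideal P \<longleftrightarrow> (\<forall>x\<in>P. \<exists>a. a \<notin> P \<and> inf x a = bot)"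
proof (intro iffI ballI)
  fix x assume min: "minimal_prime_lattice_ideal P" and x: "x \<in> P"
  have P: "lattice_ideal P" "P \<noteq> UNIV" "\<And>a b. inf a b \<in> P \<Longrightarrow> a \<in> P \<or> b \<in> P"
    using prime unfolding prime_lattice_ideal_def by blast+
  show "\<exists>a. a \<notin> P \<and> inf x a = bot"
  proof (rule ccontr)
    assume no: "\<not> (\<exists>a. a \<notin> P \<and> inf x a = bot)"
    \<comment> \<open>An ideal avoiding this set cannot contain \<open>x\<close>, nor any \<open>a \<notin> P\<close>, since \<open>inf x a\<close> lies below both.\<close>
    let ?F = "inf x ` (- P)"
    have "lattice_ideal {bot::'a}"
      unfolding lattice_ideal_def by (auto simp: bot_unique)
    moreover have "{bot} \<inter> ?F = {}" using no by force
    moreover have "?F \<noteq> {}" using P(2) by blast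
    moreover have "inf f g \<in> ?F" if "f \<in> ?F" "g \<in> ?F" for f g
    proof -
      from that obtain a b where "a \<notin> P" "f = inf x a" "b \<notin> P" "g = inf x b" by blast
      then have "inf a b \<notin> P" and "inf f g = inf x (inf a b)"
        using P(3) by (blast, simp add: inf_left_commute inf_assoc)
      then show ?thesis by blast
    qed
    ultimately obtain Q where Q: "prime_lattice_ideal Q" "Q \<inter> ?F = {}"
      by (rule prime_ideal_separation)
    have down_Q: "y \<in> Q" if "z \<in> Q" "y \<le> z" for y z
      using Q(1) that unfolding prime_lattice_ideal_def lattice_ideal_def by blast
    have "Q \<subseteq> P"
    proof
      fix q assume "q \<in> Q"
      then have "inf x q \<in> Q" using down_Q inf.cobounded2 by blast
      then show "q \<in> P" using Q(2) by blast
    qed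
    moreover have "x \<notin> Q"
    proof
      assume "x \<in> Q"
      then have "inf x a \<in> Q" for a using down_Q inf.cobounded1 by blast
      then show False using Q(2) P(2) by blast
    qed
    ultimately show False
      using min Q(1) x unfolding minimal_prime_lattice_ideal_def by blast
  qed
next
  assume disj: "\<forall>x\<in>P. \<exists>a. a \<notin> P \<and> inf x a = bot"
  have "Q = P" if Q: "prime_lattice_ideal Q" "Q \<subseteq> P" for Q
  proof
    show "P \<subseteq> Q"
    proof
      fix x assume "x \<in> P"
      then obtain a where a: "a \<notin> P" "inf x a = bot" using disj by blast
      have "lattice_ideal Q"
        using Q(1) unfolding prime_lattice_ideal_def by simp
      then have "inf x a \<in> Q"
        unfolding a(2) by (rule bot_mem_lattice_ideal)
      then show "x \<in> Q"
        using Q a(1) unfolding prime_lattice_ideal_def by (meson subsetD)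
    qed
  qed (fact Q(2))
  then show "minimal_prime_lattice_ideal P"
    using prime unfolding minimal_prime_lattice_ideal_def by simp
qed

theorem theorem4p3:
  fixes P :: "'a::decomposable_lattice set"
  assumes "prime_lattice_ideal P"
  shows "(minimal_prime_lattice_ideal P \<longleftrightarrow> P = \<Union> {perp a | a. a \<notin> P})
       \<and> (P = \<Union> {perp a | a. a \<notin> P} \<longleftrightarrow> (\<forall>x\<in>P. \<not> perp x \<subseteq> P))"
proof -
  let ?D = "\<forall>x\<in>P. \<exists>a. a \<notin> P \<and> inf x a = bot"
  have "bot \<in> P"
    using assms bot_mem_lattice_ideal unfolding prime_lattice_ideal_def by blast
  then have "x \<in> P" if "a \<notin> P" "inf x a = bot" for x a
    using assms that unfolding prime_lattice_ideal_def by metis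
  then have "\<Union> {perp a | a. a \<notin> P} \<subseteq> P"
    unfolding perp_def by blast
  then have "P = \<Union> {perp a | a. a \<notin> P} \<longleftrightarrow> P \<subseteq> \<Union> {perp a | a. a \<notin> P}"
    by blast
  also have "\<dots> \<longleftrightarrow> ?D"
    unfolding perp_def by blast
  finally have union: "P = \<Union> {perp a | a. a \<notin> P} \<longleftrightarrow> ?D" .
  have "(\<forall>x\<in>P. \<not> perp x \<subseteq> P) \<longleftrightarrow> ?D"
    unfolding perp_def by (auto simp: inf_commute)
  then show ?thesis
    using union minimal_prime_ideal_iff_disjoint[OF assms] by blast
qed

end
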